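(* Let $\tau$ be a trajectory of length $T\ge 1$ for a task $x$, with observation sequence $(o_1,\ldots,o_{T+1})$ and outcome reward $R(\tau)\in\{0,1\}$. Let $D(\tau)=|\{o_1,\ldots,o_{T+1}\}|$ be the number of distinct observations visited by $\tau$, and let $P(\tau)=\frac{1}{T}\sum_{t=1}^{T}\mathbf{1}\left[o_{t+1}\notin\{o_1,\ldots,o_t\}\right]$ be its progress score. Then: (i) $P(\tau)=\bigl(D(\tau)-1\bigr)/T$; (ii) if the task $x$ is $m_x$-separated, then $\{\tau : R(\tau)=1\}\subseteq\{\tau : P(\tau)\ge (m_x-1)/T\}$, where $T$ denotes the length of the trajectory $\tau$; that is, every trajectory $\tau$ (of length $T$) for task $x$ with $R(\tau)=1$ satisfies $P(\tau)\ge (m_x-1)/T$.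
   Context: A trajectory of length $T$ for a task $x$ is a finite sequence of observations and actions $o_1,a_1,o_2,a_2,\ldots,o_T,a_T$ together with the final observation $o_{T+1}$ returned by the environment after $a_T$; observations are elements of some fixed set and are compared by equality. Each trajectory receives a binary outcome reward $R(\tau)\in\{0,1\}$, with $R(\tau)=1$ meaning that the task is completed (success). A task $x$ is called $m_x$-separated, for an integer $m_x\ge 2$, if completing it requires visiting at least $m_x$ distinct observations, i.e. every trajectory $\tau$ for task $x$ with $R(\tau)=1$ satisfies $D(\tau)\ge m_x$. *)

theory Defs
  imports Complex_Main
begin

text \<open>\<open>Trajectory [(o\<^sub>1, a\<^sub>1), \<dots>, (o\<^sub>T, a\<^sub>T)] o'\<close> stands for \<open>o\<^sub>1, a\<^sub>1, \<dots>, o\<^sub>T, a\<^sub>T\<close> with \<open>o' = o\<^sub>T\<^sub>+\<^sub>1\<close>, the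
  observation returned after \<open>a\<^sub>T\<close>.\<close>

datatype ('o, 'a) trajectory =
  Trajectory (steps: "('o \<times> 'a) list") (final_obs: 'o)

definition traj_length :: "('o, 'a) trajectory \<Rightarrow> nat" where
  "traj_length \<tau> = length (steps \<tau>)"

text \<open>Observations are indexed from 1; only the indices \<open>1, \<dots>, T + 1\<close> are meaningful.\<close>

definition obs :: "('o, 'a) trajectory \<Rightarrow> nat \<Rightarrow> 'o" where
  "obs \<tau> t = (map fst (steps \<tau>) @ [final_obs \<tau>]) ! (t - 1)"

definition distinct_obs :: "('o, 'a) trajectory \<Rightarrow> nat" where
  "distinct_obs \<tau> = card (obs \<tau> ` {1..traj_length \<tau> + 1})"

definition progress :: "('o, 'a) trajectory \<Rightarrow> real" where
  "progress \<tau> = 1 / real (traj_length \<tau>) *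
     (\<Sum>t = 1..traj_length \<tau>. of_bool (obs \<tau> (t + 1) \<notin> obs \<tau> ` {1..t}))"

text \<open>\<open>trajs x\<close> is the set of trajectories for the task \<open>x\<close>, and \<open>R x \<tau>\<close> the reward of such a
  trajectory \<open>\<tau>\<close>.\<close>

definition separated ::
  "('x \<Rightarrow> ('o, 'a) trajectory set) \<Rightarrow> ('x \<Rightarrow> ('o, 'a) trajectory \<Rightarrow> nat) \<Rightarrow> nat \<Rightarrow> 'x \<Rightarrow> bool" where
  "separated trajs R m x \<longleftrightarrow>
     m \<ge> 2 \<and> (\<forall>\<tau>\<in>trajs x. R x \<tau> = 1 \<longrightarrow> distinct_obs \<tau> \<ge> m)"

end

theory Submission
  imports Defs
begin

text \<open>Every visited observation has exactly one first visit. The progress sum counts the first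
  visits at indices from 2 on, so it misses only that of the initial observation and equals the
  number of distinct observations minus 1 (\<open>sum_new_values_eq_card\<close>). The bound for
  successful trajectories follows on dividing by the length.\<close>

lemma sum_new_values_eq_card:
  fixes f :: "nat \<Rightarrow> 'b"
  shows "(\<Sum>t = 1..n. of_bool (f (t + 1) \<notin> f ` {1..t}) :: real) = real (card (f ` {1..n + 1})) - 1"
proof (induction n)
  case 0
  then show ?case by simp
next
  case (Suc n)
  have "f ` {1..Suc n + 1} = insert (f (Suc n + 1)) (f ` {1..Suc n})"
    by (simp add: atLeastAtMostSuc_conv)
  \<comment> \<open>The cardinality grows by exactly the summand for
    \<open>t = Suc n\<close>.\<close>
  then have "real (card (f ` {1..Suc n + 1})) =
      real (card (f ` {1..n + 1})) + of_bool (f (Suc n + 1) \<notin> f ` {1..Suc n})"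
    by (simp add: card_insert_if)
  with Suc.IH show ?case
    by simp
qed

lemma progress_eq:
  "progress \<tau> = (real (distinct_obs \<tau>) - 1) / real (traj_length \<tau>)"
  unfolding progress_def distinct_obs_def sum_new_values_eq_card by simp

theorem proposition1:
  fixes trajs :: "'x \<Rightarrow> ('o, 'a) trajectory set"
    and R :: "'x \<Rightarrow> ('o, 'a) trajectory \<Rightarrow> nat"
    and x :: 'x
    and m :: nat
  assumes "\<forall>\<tau>\<in>trajs x. traj_length \<tau> \<ge> 1"
    and "\<forall>\<tau>\<in>trajs x. R x \<tau> \<in> {0, 1}"
  shows "(\<forall>\<tau>\<in>trajs x. progress \<tau> = (real (distinct_obs \<tau>) - 1) / real (traj_length \<tau>)) \<and>
    (separated trajs R m x \<longrightarrow>
      {\<tau> \<in> trajs x. R x \<tau> = 1} \<subseteq>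
      {\<tau> \<in> trajs x. progress \<tau> \<ge> (real m - 1) / real (traj_length \<tau>)})"
  \<comment> \<open>Separation bounds the numerator below by \<open>real m - 1\<close>; dividing by
    a nonnegative length preserves this.\<close>
  by (auto simp: progress_eq separated_def intro!: divide_right_mono)

end
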